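(* Let $f \colon \mathbb{R}^n \to \mathbb{R}$ be $L$-smooth and $\mu$-strongly convex with respect to the given inner product, with $0 < \mu \le L$, and let $x^*$ be its unique global minimizer. Let $A$ be a symmetric (with respect to the given inner product) and positive definite matrix whose eigenvalues are contained in the interval $[\lambda, \Lambda]$, where $0 < \lambda \le \Lambda$. Define \[ \bar h = \frac{2}{L/\lambda + \mu/\Lambda}. \] Let $x \in \mathbb{R}^n$, let $0 \le h \le \bar h$, and set $x^+ = x - h A^{-1} \nabla f(x)$. Then \[ f(x^+) - f(x^* ) \le \left(1 - \frac{h\mu}{\Lambda}\right)^2 (f(x) - f(x^* )). \] In particular, the step size $h = \bar h$ yields \[ f(x^+) - f(x^* ) \le \left(\frac{\kappa_{f,A} - 1}{\kappa_{f,A} + 1}\right)^2 (f(x) - f(x^* )), \qquad \kappa_{f,A} = \frac{L}{\mu}\,\frac{\Lambda}{\lambda}. \]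
   Context: $\mathbb{R}^n$ is equipped with an arbitrary fixed inner product $\langle \cdot,\cdot\rangle$ with corresponding norm $\|\cdot\|$, and $\nabla f$ denotes the gradient of the differentiable function $f$ with respect to this inner product. The function $f$ is $L$-smooth if $\|\nabla f(x) - \nabla f(y)\| \le L\|x-y\|$ for all $x,y \in \mathbb{R}^n$, and $\mu$-strongly convex if $f(x) \ge f(y) + \langle \nabla f(y), x-y\rangle + \frac{\mu}{2}\|x-y\|^2$ for all $x,y\in\mathbb{R}^n$. A matrix $A$ is symmetric with respect to the given inner product if $\langle Ax,y\rangle = \langle x, Ay\rangle$ for all $x,y$, and positive definite if moreover $\langle x, Ax\rangle > 0$ for all $x \ne 0$. *)

theory Defs
  imports "HOL-Analysis.Analysis"
begin

definition is_inner_product :: "(real^'n \<Rightarrow> real^'n \<Rightarrow> real) \<Rightarrow> bool" where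
  "is_inner_product ip \<longleftrightarrow>
     bilinear ip \<and> (\<forall>x y. ip x y = ip y x) \<and> (\<forall>x. x \<noteq> 0 \<longrightarrow> 0 < ip x x)"

definition ip_norm :: "(real^'n \<Rightarrow> real^'n \<Rightarrow> real) \<Rightarrow> real^'n \<Rightarrow> real" where
  "ip_norm ip x = sqrt (ip x x)"

(* The Frechet derivative on the right is the library's, with respect to the standard norm;
   since all norms on real^'n are equivalent, it is also the derivative with respect to
   ip_norm ip.  Meaningful only where f is differentiable. *)
definition gradient ::
  "(real^'n \<Rightarrow> real^'n \<Rightarrow> real) \<Rightarrow> (real^'n \<Rightarrow> real) \<Rightarrow> real^'n \<Rightarrow> real^'n" where
  "gradient ip f x = (THE g. (f has_derivative (\<lambda>v. ip g v)) (at x))"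

definition L_smooth ::
  "(real^'n \<Rightarrow> real^'n \<Rightarrow> real) \<Rightarrow> real \<Rightarrow> (real^'n \<Rightarrow> real) \<Rightarrow> bool" where
  "L_smooth ip L f \<longleftrightarrow>
     (\<forall>x. f differentiable (at x)) \<and>
     (\<forall>x y. ip_norm ip (gradient ip f x - gradient ip f y) \<le> L * ip_norm ip (x - y))"

definition strongly_convex ::
  "(real^'n \<Rightarrow> real^'n \<Rightarrow> real) \<Rightarrow> real \<Rightarrow> (real^'n \<Rightarrow> real) \<Rightarrow> bool" where
  "strongly_convex ip \<mu> f \<longleftrightarrow>
     (\<forall>x. f differentiable (at x)) \<and>
     (\<forall>x y. f x \<ge> f y + ip (gradient ip f y) (x - y) + \<mu> / 2 * (ip_norm ip (x - y))\<^sup>2)"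

definition symmetric_wrt :: "(real^'n \<Rightarrow> real^'n \<Rightarrow> real) \<Rightarrow> real^'n^'n \<Rightarrow> bool" where
  "symmetric_wrt ip A \<longleftrightarrow> (\<forall>x y. ip (A *v x) y = ip x (A *v y))"

definition pos_def_wrt :: "(real^'n \<Rightarrow> real^'n \<Rightarrow> real) \<Rightarrow> real^'n^'n \<Rightarrow> bool" where
  "pos_def_wrt ip A \<longleftrightarrow> symmetric_wrt ip A \<and> (\<forall>x. x \<noteq> 0 \<longrightarrow> 0 < ip x (A *v x))"

(* Only real eigenvalues are considered; a matrix that is symmetric with respect to an
   inner product has no others. *)
definition is_eigenvalue :: "real^'n^'n \<Rightarrow> real \<Rightarrow> bool" where
  "is_eigenvalue A a \<longleftrightarrow> (\<exists>v. v \<noteq> 0 \<and> A *v v = a *\<^sub>R v)"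

end

theory Submission
  imports Defs
begin

text \<open>The preconditioned step is an ordinary gradient step in another geometry. With respect to the
inner product \<open>B v w = ip v (A w)\<close> the gradient of \<open>f\<close> is \<open>A\<^sup>-\<^sup>1 \<nabla>f\<close>. The eigenvalues of \<open>A\<close>
bound \<open>B v v\<close> between \<open>lam\<close> and \<open>Lam\<close> times \<open>ip v v\<close> (lemma \<open>Rayleigh_bounds\<close>), so the quadratic
upper and lower bounds that smoothness and strong convexity give for \<open>f\<close> become bounds for \<open>B\<close>
with constants \<open>L / lam\<close> and \<open>\<mu> / Lam\<close>. The upper bound comes from \<open>descent_lemma\<close>, the lower one
is the definition of strong convexity. It remains to analyse gradient descent in an arbitrary
inner product, using only these two bounds.

A step shorter than \<open>2 / (L + \<mu>)\<close> is the optimal step for a larger smoothness constant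
(\<open>gradient_step_rate\<close>), so the optimal step suffices. There, for \<open>\<mu> < L\<close>, the bound is a positive combination
of three instances of \<open>interpolation_inequality\<close>, one for each pair among the current point, the
next point and the minimizer; the slack of the combination is a single squared norm
(\<open>gradient_step_optimal\<close>).\<close>

section \<open>Inner products\<close>

lemma ip_bilinear: "is_inner_product ip \<Longrightarrow> bilinear ip"
  and ip_commute: "is_inner_product ip \<Longrightarrow> ip x y = ip y x"
  and ip_pos: "is_inner_product ip \<Longrightarrow> x \<noteq> 0 \<Longrightarrow> 0 < ip x x"
  unfolding is_inner_product_def by blast+

lemmas bilinear_expand =
  bilinear_ladd bilinear_radd bilinear_lsub bilinear_rsub
  bilinear_lmul bilinear_rmul bilinear_lneg bilinear_rneg bilinear_lzero bilinear_rzero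

lemma ip_nonneg: "is_inner_product ip \<Longrightarrow> 0 \<le> ip x x"
  by (cases "x = 0") (auto simp: bilinear_lzero[OF ip_bilinear] dest: ip_pos[of ip x] less_imp_le)

text \<open>If \<open>B v w\<close> were nonzero, the form along the line \<open>w + t v\<close> would be affine in \<open>t\<close> (as
\<open>B v v = 0\<close>) with nonzero slope, hence negative somewhere.\<close>

lemma psd_form_vanishes:
  fixes B :: "real^'n \<Rightarrow> real^'n \<Rightarrow> real"
  assumes bl: "bilinear B" and comm: "\<And>x y. B x y = B y x"
    and psd: "\<And>x. 0 \<le> B x x" and v: "B v v = 0"
  shows "B v w = 0"
proof (rule ccontr)
  assume ne: "B v w \<noteq> 0"
  \<comment> \<open>the parameter at which the affine function \<open>B w w + 2 t B v w\<close> equals \<open>-1\<close>\<close>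
  define t where "t = - (B w w + 1) / (2 * B v w)"
  have "B (w + t *\<^sub>R v) (w + t *\<^sub>R v) = B w w + 2 * t * B v w"
    using v comm[of w v] by (simp add: bilinear_expand[OF bl] algebra_simps)
  also have "\<dots> = -1"
    using ne by (simp add: t_def field_simps)
  finally show False
    using psd[of "w + t *\<^sub>R v"] by simp
qed

lemma ip_norm_sq: "is_inner_product ip \<Longrightarrow> (ip_norm ip x)\<^sup>2 = ip x x"
  by (simp add: ip_norm_def ip_nonneg)

lemma ip_Cauchy_Schwarz:
  assumes ip: "is_inner_product ip"
  shows "ip x y \<le> ip_norm ip x * ip_norm ip y"
proof (cases "x = 0 \<or> y = 0")
  case True
  then show ?thesis
    by (auto simp: ip_norm_def bilinear_expand[OF ip_bilinear[OF ip]])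
next
  case False
  define a b where "a = ip_norm ip x" and "b = ip_norm ip y"
  have ab: "0 < a" "0 < b"
    using False ip_pos[OF ip] by (auto simp: a_def b_def ip_norm_def)
  have "0 \<le> ip (b *\<^sub>R x - a *\<^sub>R y) (b *\<^sub>R x - a *\<^sub>R y)"
    by (rule ip_nonneg[OF ip])
  also have "\<dots> = b\<^sup>2 * ip x x + a\<^sup>2 * ip y y - 2 * (a * b) * ip x y"
    using ip_commute[OF ip, of y x]
    by (simp add: bilinear_expand[OF ip_bilinear[OF ip]] algebra_simps power2_eq_square)
  also have "\<dots> = 2 * (a * b) * (a * b - ip x y)"
    unfolding ip_norm_sq[OF ip, symmetric] a_def[symmetric] b_def[symmetric]
    by (simp add: algebra_simps power2_eq_square)
  finally have "0 \<le> a * b - ip x y"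
    using ab zero_le_mult_iff[of "2 * (a * b)"] mult_pos_pos[OF ab] by simp
  then show ?thesis by (simp add: a_def b_def)
qed

text \<open>The representing vector lets the gradient, defined by a definite description, be identified
with the Frechet derivative. In finite dimension representability is a dimension count: the map
\<open>T\<close> that turns \<open>ip g\<close> into a vector for the standard dot product is linear and injective,
hence surjective.\<close>

lemma ip_Riesz:
  fixes ip :: "real^'n \<Rightarrow> real^'n \<Rightarrow> real"
  assumes ip: "is_inner_product ip" and lin: "linear \<phi>"
  shows "\<exists>!g. \<phi> = (\<lambda>v. ip g v)"
proof -
  note bl = ip_bilinear[OF ip]
  define T where "T g = (\<Sum>b\<in>Basis. ip g b *\<^sub>R b)" for g :: "real^'n"
  have rep: "(\<Sum>b\<in>Basis. \<psi> b *\<^sub>R b) \<bullet> v = \<psi> v"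
    if "linear \<psi>" for \<psi> :: "real^'n \<Rightarrow> real" and v
  proof -
    have "\<psi> v = \<psi> (\<Sum>b\<in>Basis. (v \<bullet> b) *\<^sub>R b)"
      by (simp add: euclidean_representation)
    also have "\<dots> = (\<Sum>b\<in>Basis. (v \<bullet> b) * \<psi> b)"
      by (simp add: linear_sum[OF that] linear_cmul[OF that])
    finally show ?thesis
      by (simp add: inner_sum_left inner_commute[of v] mult.commute)
  qed
  have T: "T g \<bullet> v = ip g v" for g v
    unfolding T_def using bl by (intro rep) (simp add: bilinear_def)
  have linT: "linear T"
    by (intro linearI)
      (simp_all add: T_def bilinear_expand[OF bl] scaleR_add_left sum.distrib scaleR_sum_right)
  have inj: "inj T"
  proof (subst linear_injective_0[OF linT], intro allI impI)
    fix g assume "T g = 0"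
    then have "ip g g = 0" using T[of g g] by simp
    then show "g = 0" using ip_pos[OF ip, of g] by force
  qed
  have "surj T"
    by (rule linear_injective_imp_surjective[OF linT inj refl])
  then obtain g where "T g = (\<Sum>b\<in>Basis. \<phi> b *\<^sub>R b)"
    by (metis surjD)
  then have "\<phi> = (\<lambda>v. ip g v)"
    using T rep[OF lin] by (metis (no_types, lifting))
  moreover have "g' = g" if "\<phi> = (\<lambda>v. ip g' v)" for g'
  proof -
    have "T g' \<bullet> v = T g \<bullet> v" for v
      using that \<open>\<phi> = (\<lambda>v. ip g v)\<close> by (metis T)
    then have "T g' = T g"
      by (metis vector_eq_rdot)
    then show ?thesis using inj by (simp add: inj_eq)
  qed
  ultimately show ?thesis by blast
qed

section \<open>Gradients and the quadratic upper bound\<close>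

lemma has_derivative_gradient:
  fixes ip :: "real^'n \<Rightarrow> real^'n \<Rightarrow> real"
  assumes ip: "is_inner_product ip" and diff: "f differentiable (at x)"
  shows "(f has_derivative (\<lambda>v. ip (gradient ip f x) v)) (at x)"
proof -
  obtain f' where f': "(f has_derivative f') (at x)"
    using diff by (auto simp: differentiable_def)
  have "\<exists>!g. f' = (\<lambda>v. ip g v)"
    by (rule ip_Riesz[OF ip has_derivative_linear[OF f']])
  then have "\<exists>!g. (f has_derivative (\<lambda>v. ip g v)) (at x)"
    using f' has_derivative_unique by metis
  then show ?thesis
    unfolding gradient_def by (rule theI')
qed

text \<open>Along the segment from \<open>x\<close> to \<open>y\<close>, the difference between \<open>f\<close> and the quadratic model has a
nonpositive derivative: Cauchy-Schwarz and the Lipschitz bound control the change of the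
gradient.\<close>

lemma descent_lemma:
  fixes ip :: "real^'n \<Rightarrow> real^'n \<Rightarrow> real"
  assumes ip: "is_inner_product ip" and smooth: "L_smooth ip L f"
  shows "f y \<le> f x + ip (gradient ip f x) (y - x) + L / 2 * ip (y - x) (y - x)"
proof -
  note bl = ip_bilinear[OF ip]
  define d where "d = y - x"
  define \<phi> where "\<phi> t = f (x + t *\<^sub>R d) - t * ip (gradient ip f x) d - L / 2 * t\<^sup>2 * ip d d" for t
  define \<phi>' where "\<phi>' t = ip (gradient ip f (x + t *\<^sub>R d)) d - ip (gradient ip f x) d - L * t * ip d d" for t
  have der: "(\<phi> has_real_derivative \<phi>' t) (at t)" for t
  proof -
    have "((\<lambda>t. x + t *\<^sub>R d) has_derivative (\<lambda>s. s *\<^sub>R d)) (at t)"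
      by (auto intro!: derivative_eq_intros)
    moreover have "(f has_derivative (\<lambda>v. ip (gradient ip f (x + t *\<^sub>R d)) v)) (at (x + t *\<^sub>R d))"
      using smooth by (intro has_derivative_gradient[OF ip]) (simp add: L_smooth_def)
    ultimately have "((\<lambda>t. f (x + t *\<^sub>R d)) has_derivative
        (\<lambda>s. ip (gradient ip f (x + t *\<^sub>R d)) (s *\<^sub>R d))) (at t)"
      by (rule has_derivative_compose)
    then have "((\<lambda>t. f (x + t *\<^sub>R d)) has_real_derivative ip (gradient ip f (x + t *\<^sub>R d)) d) (at t)"
      by (simp add: has_field_derivative_def bilinear_rmul[OF bl] mult.commute[of _ "ip _ _"])
    then show ?thesis
      unfolding \<phi>_def \<phi>'_def by (auto intro!: derivative_eq_intros)
  qed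
  have nonpos: "\<phi>' t \<le> 0" if "0 \<le> t" for t
  proof -
    let ?g = "gradient ip f (x + t *\<^sub>R d) - gradient ip f x"
    have "ip ?g d \<le> ip_norm ip ?g * ip_norm ip d"
      by (rule ip_Cauchy_Schwarz[OF ip])
    also have "\<dots> \<le> L * ip_norm ip (t *\<^sub>R d) * ip_norm ip d"
    proof (rule mult_right_mono)
      show "ip_norm ip ?g \<le> L * ip_norm ip (t *\<^sub>R d)"
        using smooth unfolding L_smooth_def by (metis add_diff_cancel_left')
    qed (simp add: ip_norm_def ip_nonneg[OF ip])
    also have "ip_norm ip (t *\<^sub>R d) = t * ip_norm ip d"
      using that by (simp add: ip_norm_def bilinear_expand[OF bl] real_sqrt_mult)
    also have "L * (t * ip_norm ip d) * ip_norm ip d = L * t * ip d d"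
      by (simp add: ip_norm_sq[OF ip, symmetric] power2_eq_square)
    finally show ?thesis
      by (simp add: \<phi>'_def bilinear_lsub[OF bl])
  qed
  have "\<phi> 1 \<le> \<phi> 0"
    by (rule DERIV_nonpos_imp_nonincreasing[of 0 1]) (use der nonpos in auto)
  then show ?thesis
    by (simp add: \<phi>_def d_def)
qed

section \<open>Eigenvalue bounds for the quadratic form\<close>

text \<open>The Rayleigh quotient attains its minimum \<open>m\<close> on the (compact) standard unit sphere, and being
homogeneous of degree 0 it is then at least \<open>m\<close> at every nonzero vector. At a minimizer \<open>u\<close> the positive
semidefinite form \<open>ip v ((A - m) w)\<close> vanishes on \<open>(u, u)\<close>, so \<open>u\<close> lies in its
radical, which means \<open>A u = m u\<close>.\<close>

lemma smallest_eigenvalue_Rayleigh: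
  fixes ip :: "real^'n \<Rightarrow> real^'n \<Rightarrow> real"
  assumes ip: "is_inner_product ip" and sym: "symmetric_wrt ip A"
  shows "\<exists>m. is_eigenvalue A m \<and> (\<forall>v. m * ip v v \<le> ip v (A *v v))"
proof -
  note bl = ip_bilinear[OF ip]
  have bb: "bounded_bilinear ip"
    using bl by (simp add: bilinear_conv_bounded_bilinear)
  define R where "R v = ip v (A *v v) / ip v v" for v
  have nz: "ip v v \<noteq> 0" if "v \<noteq> 0" for v
    using ip_pos[OF ip that] by simp
  have "ip v v \<noteq> 0" if "v \<in> sphere 0 1" for v
    using that by (intro nz) auto
  then have cont: "continuous_on (sphere 0 1) R"
    unfolding R_def
    by (intro continuous_on_divide bounded_bilinear.continuous_on[OF bb] continuous_on_id
        linear_continuous_on ballI matrix_vector_mul_bounded_linear)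
  have "sphere (0 :: real^'n) 1 \<noteq> {}" by simp
  then obtain u :: "real^'n" where u: "u \<in> sphere 0 1" "\<And>v. v \<in> sphere 0 1 \<Longrightarrow> R u \<le> R v"
    using continuous_attains_inf[OF compact_sphere _ cont] by blast
  define m where "m = R u"
  have u0: "u \<noteq> 0" using u by auto
  have le: "m * ip v v \<le> ip v (A *v v)" for v
  proof (cases "v = 0")
    case False
    have "R (inverse (norm v) *\<^sub>R v) = R v"
      using False by (simp add: R_def matrix_vector_mult_scaleR bilinear_expand[OF bl])
    moreover have "inverse (norm v) *\<^sub>R v \<in> sphere 0 1" using False by simp
    ultimately have "m \<le> R v" using u(2) by (metis m_def)
    then show ?thesis
      using ip_pos[OF ip False] by (simp add: R_def pos_le_divide_eq)
  qed (simp add: bilinear_expand[OF bl])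
  define B where "B v w = ip v (A *v w - m *\<^sub>R w)" for v w
  have "B w u = 0" for w
  proof -
    have "bilinear B"
      unfolding bilinear_def B_def
      by (auto intro!: linearI simp: bilinear_expand[OF bl] matrix_vector_right_distrib
          matrix_vector_mult_scaleR algebra_simps)
    moreover have comm: "B v w = B w v" for v w
      using sym ip_commute[OF ip] by (simp add: B_def symmetric_wrt_def bilinear_expand[OF bl])
    moreover have "0 \<le> B v v" for v
      using le[of v] by (simp add: B_def bilinear_expand[OF bl])
    moreover have "B u u = 0"
      using nz[OF u0] by (simp add: B_def m_def R_def bilinear_expand[OF bl])
    ultimately show ?thesis
      by (metis psd_form_vanishes)
  qed
  then have "ip (A *v u - m *\<^sub>R u) (A *v u - m *\<^sub>R u) = 0"
    by (simp add: B_def)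
  then have "A *v u = m *\<^sub>R u"
    using ip_pos[OF ip, of "A *v u - m *\<^sub>R u"] by force
  then show ?thesis
    using u0 le by (auto simp: is_eigenvalue_def)
qed

text \<open>The upper bound is the lower bound for \<open>- A\<close>.\<close>

lemma Rayleigh_bounds:
  fixes ip :: "real^'n \<Rightarrow> real^'n \<Rightarrow> real"
  assumes ip: "is_inner_product ip" and sym: "symmetric_wrt ip A"
    and eig: "\<forall>a. is_eigenvalue A a \<longrightarrow> a \<in> {lam..Lam}"
  shows "lam * ip v v \<le> ip v (A *v v)" and "ip v (A *v v) \<le> Lam * ip v v"
proof -
  note bl = ip_bilinear[OF ip]
  have neg: "(- A) *v w = - (A *v w)" for w
    by (simp add: vec_eq_iff matrix_vector_mult_def sum_negf)
  obtain m where m: "is_eigenvalue A m" "m * ip v v \<le> ip v (A *v v)"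
    using smallest_eigenvalue_Rayleigh[OF ip sym] by blast
  have "lam * ip v v \<le> m * ip v v"
    using eig m(1) by (intro mult_right_mono ip_nonneg[OF ip]) auto
  with m(2) show "lam * ip v v \<le> ip v (A *v v)" by linarith
  have "symmetric_wrt ip (- A)"
    using sym by (simp add: symmetric_wrt_def neg bilinear_expand[OF bl])
  then obtain k where k: "is_eigenvalue (- A) k" "k * ip v v \<le> ip v ((- A) *v v)"
    using smallest_eigenvalue_Rayleigh[OF ip] by blast
  have "is_eigenvalue A (- k)"
    using k(1) unfolding is_eigenvalue_def neg by (metis minus_minus scaleR_minus_left)
  then have "- k * ip v v \<le> Lam * ip v v"
    using eig by (intro mult_right_mono ip_nonneg[OF ip]) auto
  with k(2) show "ip v (A *v v) \<le> Lam * ip v v"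
    by (simp add: neg bilinear_expand[OF bl])
qed

section \<open>Gradient steps in an arbitrary inner product\<close>

text \<open>The sharp relation between values and gradients of a smooth strongly convex function at two
points. At every third point \<open>z\<close> the lower bound expanded at \<open>x\<close> lies below the upper bound
expanded at \<open>y\<close>; as \<open>\<mu> < L\<close>, the gap between the two, as a function of \<open>z\<close>, is a strictly
convex quadratic, and its minimum gives the strongest consequence.\<close>

lemma interpolation_inequality:
  fixes B :: "real^'n \<Rightarrow> real^'n \<Rightarrow> real"
  assumes B: "is_inner_product B" and less: "\<mu> < L"
    and lower: "\<And>x y. f x + B (G x) (y - x) + \<mu> / 2 * B (y - x) (y - x) \<le> f y"
    and upper: "\<And>x y. f y \<le> f x + B (G x) (y - x) + L / 2 * B (y - x) (y - x)"
  shows "\<mu> * L * B (y - x) (y - x) + 2 * L * B (G x) (y - x) - 2 * \<mu> * B (G y) (y - x)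
      + B (G y - G x) (G y - G x) \<le> 2 * (L - \<mu>) * (f y - f x)"
proof -
  note bl = ip_bilinear[OF B]
  define c d where "c = 1 / (L - \<mu>)" and "d = y - x"
  define r where "r = G y - G x - \<mu> *\<^sub>R d"
  \<comment> \<open>the minimizer of upper minus lower bound, where their gradients in \<open>z\<close> agree\<close>
  define z where "z = y - c *\<^sub>R r"
  have Gy: "G y = r + G x + \<mu> *\<^sub>R d" by (simp add: r_def)
  have zx: "z - x = d - c *\<^sub>R r" and zy: "z - y = - (c *\<^sub>R r)"
    by (simp_all add: z_def d_def)
  have "f x + B (G x) (d - c *\<^sub>R r) + \<mu> / 2 * B (d - c *\<^sub>R r) (d - c *\<^sub>R r)
      \<le> f y + B (r + G x + \<mu> *\<^sub>R d) (- (c *\<^sub>R r)) + L / 2 * B (- (c *\<^sub>R r)) (- (c *\<^sub>R r))"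
    using order_trans[OF lower[of x z] upper[of z y]] unfolding zx zy Gy .
  then have "B (G x) d + \<mu> / 2 * B d d + (c - ((L - \<mu>) * c) * c / 2) * B r r \<le> f y - f x"
    using ip_commute[OF B, of r d]
    by (simp add: bilinear_expand[OF bl] algebra_simps add_divide_distrib diff_divide_distrib)
  moreover have "(L - \<mu>) * c = 1"
    using less by (simp add: c_def)
  ultimately have "B (G x) d + \<mu> / 2 * B d d + c / 2 * B r r \<le> f y - f x"
    by simp
  then have "2 * (L - \<mu>) * (B (G x) d + \<mu> / 2 * B d d + c / 2 * B r r) \<le> 2 * (L - \<mu>) * (f y - f x)"
    using less by (intro mult_left_mono) auto
  also have "2 * (L - \<mu>) * (B (G x) d + \<mu> / 2 * B d d + c / 2 * B r r)
      = (L - \<mu>) * (2 * B (G x) d + \<mu> * B d d) + ((L - \<mu>) * c) * B r r"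
    by (simp add: algebra_simps)
  also have "\<dots> = (L - \<mu>) * (2 * B (G x) d + \<mu> * B d d) + B r r"
    by (simp add: \<open>(L - \<mu>) * c = 1\<close>)
  also have "\<dots> = \<mu> * L * B d d + 2 * L * B (G x) d - 2 * \<mu> * B (G y) d + B (G y - G x) (G y - G x)"
    using ip_commute[OF B, of d "G x"] ip_commute[OF B, of d "G y"] ip_commute[OF B, of "G y" "G x"]
    by (simp add: r_def bilinear_expand[OF bl] algebra_simps)
  finally show ?thesis
    by (simp add: d_def)
qed

text \<open>The case \<open>\<mu> = L\<close> is separate because there the bounds of \<open>f\<close> coincide, \<open>f\<close> is a quadratic and the
step reaches the minimum at once. For \<open>\<mu> < L\<close> put \<open>k = (L - \<mu>) / (L + \<mu>)\<close> and let \<open>x1\<close> be the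
new point. The interpolation inequalities for the pairs \<open>(x1, x)\<close>, \<open>(x, xs)\<close> and \<open>(x1, xs)\<close> are
added with weights \<open>k\<close>, \<open>k (1 - k)\<close> and \<open>1 - k\<close>. On the function values these weights leave
\<open>k\<^sup>2 (f x - f xs) - (f x1 - f xs)\<close>, and the quadratic terms combine to a single
perfect square \<open>B q q\<close>.\<close>

lemma gradient_step_optimal:
  fixes B :: "real^'n \<Rightarrow> real^'n \<Rightarrow> real"
  assumes B: "is_inner_product B" and mu: "0 < \<mu>" "\<mu> \<le> L"
    and lower: "\<And>x y. f x + B (G x) (y - x) + \<mu> / 2 * B (y - x) (y - x) \<le> f y"
    and upper: "\<And>x y. f y \<le> f x + B (G x) (y - x) + L / 2 * B (y - x) (y - x)"
    and min: "\<And>y. f xs \<le> f y"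
  shows "f (x - (2 / (L + \<mu>)) *\<^sub>R G x) - f xs \<le> ((L - \<mu>) / (L + \<mu>))\<^sup>2 * (f x - f xs)"
proof (cases "\<mu> = L")
  case True
  note bl = ip_bilinear[OF B]
  define d where "d = xs - x"
  have "f (x - (1 / L) *\<^sub>R G x) \<le> f x - B (G x) (G x) / (2 * L)"
    using upper[of "x - (1 / L) *\<^sub>R G x" x] mu
    by (simp add: bilinear_expand[OF bl] field_simps)
  moreover have "f x - B (G x) (G x) / (2 * L) \<le> f xs"
  proof -
    have "0 \<le> B (G x + L *\<^sub>R d) (G x + L *\<^sub>R d) / (2 * L)"
      using mu by (simp add: ip_nonneg[OF B])
    also have "\<dots> = B (G x) (G x) / (2 * L) + B (G x) d + L / 2 * B d d"
      using mu ip_commute[OF B, of d "G x"] by (simp add: bilinear_expand[OF bl] field_simps)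
    finally show ?thesis
      using lower[of x xs] True by (simp add: d_def)
  qed
  ultimately show ?thesis using True mu by simp
next
  case False
  note bl = ip_bilinear[OF B]
  have less: "\<mu> < L" using False mu by simp
  \<comment> \<open>a step from the minimizer would otherwise decrease \<open>f\<close>\<close>
  have Gxs: "G xs = 0"
  proof -
    have "f xs \<le> f xs - B (G xs) (G xs) / (2 * L)"
      using order_trans[OF min upper[of "xs - (1 / L) *\<^sub>R G xs" xs]] mu
      by (simp add: bilinear_expand[OF bl] field_simps)
    then have "B (G xs) (G xs) \<le> 0"
      using mu by (simp add: divide_le_0_iff)
    then show ?thesis using ip_pos[OF B, of "G xs"] by force
  qed
  define k h where "k = (L - \<mu>) / (L + \<mu>)" and "h = 2 / (L + \<mu>)"
  have k: "0 < k" "k < 1" and mh: "\<mu> * h = 1 - k" and Lh: "L * h = 1 + k"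
    using mu less by (auto simp: k_def h_def field_simps)
  \<comment> \<open>both sides are \<open>L \<mu> h\<close>; this makes the coefficients of \<open>q\<close> match\<close>
  have weight: "L * (1 - k) = \<mu> * (1 + k)"
    unfolding mh[symmetric] Lh[symmetric] by simp
  define g where "g = G x"
  define x1 where "x1 = x - h *\<^sub>R g"
  define g1 where "g1 = G x1"
  define u where "u = x1 - xs"
  note interp = interpolation_inequality[OF B less lower upper]
  have comm: "B g u = B u g" "B g g1 = B g1 g" "B u g1 = B g1 u"
    using ip_commute[OF B] by blast+
  \<comment> \<open>quadratic parts of the three inequalities, written in terms of \<open>u\<close>, \<open>g\<close> and \<open>g1\<close>,
    with \<open>h\<close> eliminated by \<open>mh\<close> and \<open>Lh\<close>\<close>
  define P0 P1 P2 where
    "P0 = (2 * k - k\<^sup>2) * B g g + 2 * k * B g1 g + B g1 g1" and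
    "P1 = \<mu> * L * B u u - 2 * L * k * B u g - (k\<^sup>2 + 2 * k) * B g g" and
    "P2 = \<mu> * L * B u u - 2 * L * B g1 u + B g1 g1"
  have I0: "P0 \<le> 2 * (L - \<mu>) * (f x - f x1)"
  proof -
    have step: "x - x1 = h *\<^sub>R g" by (simp add: x1_def)
    have "(\<mu> * h) * (L * h) * B g g + 2 * (L * h) * B g1 g - 2 * (\<mu> * h) * B g g
        + (B g g - 2 * B g1 g + B g1 g1) \<le> 2 * (L - \<mu>) * (f x - f x1)"
      using interp[where x = x1 and y = x] unfolding step g_def[symmetric] g1_def[symmetric]
      by (simp add: bilinear_expand[OF bl] comm mult_ac)
    then show ?thesis
      unfolding mh Lh P0_def by (simp add: algebra_simps power2_eq_square)
  qed
  have I1: "P1 \<le> 2 * (L - \<mu>) * (f xs - f x)"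
  proof -
    have step: "xs - x = - (u + h *\<^sub>R g)" by (simp add: u_def x1_def)
    have "\<mu> * L * B u u + 2 * L * (\<mu> * h) * B u g + (\<mu> * h) * (L * h) * B g g
        - 2 * L * B u g - 2 * (L * h) * B g g + B g g \<le> 2 * (L - \<mu>) * (f xs - f x)"
      using interp[where x = x and y = xs] unfolding step g_def[symmetric] Gxs
      by (simp add: bilinear_expand[OF bl] comm algebra_simps)
    then show ?thesis
      unfolding mh Lh P1_def by (simp add: algebra_simps power2_eq_square)
  qed
  have I2: "P2 \<le> 2 * (L - \<mu>) * (f xs - f x1)"
  proof -
    have step: "xs - x1 = - u" by (simp add: u_def)
    show ?thesis
      using interp[where x = x1 and y = xs] unfolding P2_def step g1_def[symmetric] Gxs
      by (simp add: bilinear_expand[OF bl])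
  qed
  \<comment> \<open>completing the square in \<open>g1\<close> in the weighted sum determines \<open>q\<close>; nothing is left over\<close>
  define q where "q = g1 + k\<^sup>2 *\<^sub>R g - (\<mu> * (1 + k)) *\<^sub>R u"
  have "B q q = B g1 g1 + k^4 * B g g + (\<mu> * (1 + k)) * (\<mu> * (1 + k)) * B u u
      + 2 * k\<^sup>2 * B g1 g - 2 * (\<mu> * (1 + k)) * B g1 u
      - 2 * k\<^sup>2 * (\<mu> * (1 + k)) * B u g"
    unfolding q_def by (simp add: bilinear_expand[OF bl] comm algebra_simps power_numeral_reduce)
  also have "\<dots> = B g1 g1 + k^4 * B g g + (\<mu> * (1 + k)) * (L * (1 - k)) * B u u
      + 2 * k\<^sup>2 * B g1 g - 2 * (L * (1 - k)) * B g1 u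
      - 2 * k\<^sup>2 * (L * (1 - k)) * B u g"
    by (simp only: weight)
  also have "\<dots> = k * P0 + k * (1 - k) * P1 + (1 - k) * P2"
    unfolding P0_def P1_def P2_def by algebra
  also have "\<dots> \<le> k * (2 * (L - \<mu>) * (f x - f x1)) + k * (1 - k) * (2 * (L - \<mu>) * (f xs - f x))
      + (1 - k) * (2 * (L - \<mu>) * (f xs - f x1))"
    using I0 I1 I2 k by (intro add_mono mult_left_mono) auto
  also have "\<dots> = 2 * (L - \<mu>) * (k\<^sup>2 * (f x - f xs) - (f x1 - f xs))"
    by algebra
  finally have "0 \<le> 2 * (L - \<mu>) * (k\<^sup>2 * (f x - f xs) - (f x1 - f xs))"
    using ip_nonneg[OF B, of q] by linarith
  then have "f x1 - f xs \<le> k\<^sup>2 * (f x - f xs)"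
    using less by (simp add: zero_le_mult_iff)
  then show ?thesis
    by (simp add: x1_def h_def g_def k_def)
qed

text \<open>A bound with constant \<open>L\<close> holds with every larger constant as well. A positive step
\<open>h \<le> 2 / (L + \<mu>)\<close> is the optimal step for the constant \<open>M \<ge> L\<close> that solves \<open>h = 2 / (M + \<mu>)\<close>,
and \<open>(M - \<mu>) / (M + \<mu>)\<close> is then \<open>1 - h \<mu>\<close>.\<close>

lemma gradient_step_rate:
  fixes B :: "real^'n \<Rightarrow> real^'n \<Rightarrow> real"
  assumes B: "is_inner_product B" and mu: "0 < \<mu>" "\<mu> \<le> L"
    and lower: "\<And>x y. f x + B (G x) (y - x) + \<mu> / 2 * B (y - x) (y - x) \<le> f y"
    and upper: "\<And>x y. f y \<le> f x + B (G x) (y - x) + L / 2 * B (y - x) (y - x)"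
    and min: "\<And>y. f xs \<le> f y"
    and h: "0 \<le> h" "h \<le> 2 / (L + \<mu>)"
  shows "f (x - h *\<^sub>R G x) - f xs \<le> (1 - h * \<mu>)\<^sup>2 * (f x - f xs)"
proof (cases "h = 0")
  case False
  define M where "M = 2 / h - \<mu>"
  have LM: "L \<le> M"
    using h False mu by (simp add: M_def field_simps)
  have upper': "f y \<le> f x + B (G x) (y - x) + M / 2 * B (y - x) (y - x)" for x y
  proof -
    have "L / 2 * B (y - x) (y - x) \<le> M / 2 * B (y - x) (y - x)"
      using LM by (intro mult_right_mono ip_nonneg[OF B]) auto
    then show ?thesis using upper[of y x] by linarith
  qed
  have hM: "h = 2 / (M + \<mu>)" using False by (simp add: M_def)
  have "1 - h * \<mu> = (M - \<mu>) / (M + \<mu>)"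
    using mu LM by (simp add: hM field_simps)
  then show ?thesis
    using gradient_step_optimal[OF B mu(1) order_trans[OF mu(2) LM] lower upper' min, of x]
    by (simp add: hM)
qed simp

section \<open>Preconditioned gradient descent\<close>

theorem theorem2p1:
  fixes ip :: "real^'n \<Rightarrow> real^'n \<Rightarrow> real"
    and f :: "real^'n \<Rightarrow> real"
    and A :: "real^'n^'n"
    and L \<mu> lam Lam hbar \<kappa> :: real
    and xstar x :: "real^'n"
    and xplus :: "real \<Rightarrow> real^'n"
  assumes ip: "is_inner_product ip"
    and mu_L: "0 < \<mu>" "\<mu> \<le> L"
    and smooth: "L_smooth ip L f"
    and convex: "strongly_convex ip \<mu> f"
    and minimizer: "\<forall>y. f xstar \<le> f y"
    and symmetric: "symmetric_wrt ip A"
    and posdef: "pos_def_wrt ip A"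
    and lam_Lam: "0 < lam" "lam \<le> Lam"
    and eigenvalues: "\<forall>a. is_eigenvalue A a \<longrightarrow> a \<in> {lam..Lam}"
    and hbar: "hbar = 2 / (L / lam + \<mu> / Lam)"
    and kappa: "\<kappa> = (L / \<mu>) * (Lam / lam)"
    and xplus: "\<forall>h. xplus h = x - h *\<^sub>R (matrix_inv A *v gradient ip f x)"
  shows "(\<forall>h. 0 \<le> h \<and> h \<le> hbar \<longrightarrow>
            f (xplus h) - f xstar \<le> (1 - h * \<mu> / Lam)\<^sup>2 * (f x - f xstar)) \<and>
         f (xplus hbar) - f xstar \<le> ((\<kappa> - 1) / (\<kappa> + 1))\<^sup>2 * (f x - f xstar)"
proof -
  note bl = ip_bilinear[OF ip]
  define B where "B v w = ip v (A *v w)" for v w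
  define G where "G y = matrix_inv A *v gradient ip f y" for y
  have B: "is_inner_product B"
    unfolding is_inner_product_def
  proof (intro conjI allI impI)
    show "bilinear B"
      unfolding bilinear_def B_def
      by (auto intro!: linearI simp: bilinear_expand[OF bl] matrix_vector_right_distrib
          matrix_vector_mult_scaleR)
    show "B v w = B w v" for v w
      using symmetric ip_commute[OF ip] by (simp add: B_def symmetric_wrt_def)
    show "0 < B v v" if "v \<noteq> 0" for v
      using posdef that by (simp add: B_def pos_def_wrt_def)
  qed
  have "invertible A"
    unfolding invertible_left_inverse matrix_left_invertible_ker
  proof (intro allI impI)
    fix v assume "A *v v = 0"
    then have "B v v = 0" by (simp add: B_def bilinear_expand[OF bl])
    then show "v = 0" using ip_pos[OF B, of v] by force
  qed
  then have "A ** matrix_inv A = mat 1"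
    unfolding invertible_def matrix_inv_def by (rule conjunct1[OF someI_ex])
  then have AG: "A *v G y = gradient ip f y" for y
    by (simp add: G_def matrix_vector_mul_assoc)
  have BG: "B (G y) v = ip (gradient ip f y) v" for y v
    using symmetric by (simp add: B_def AG[symmetric] symmetric_wrt_def)
  have Lam: "0 < Lam" using lam_Lam by simp
  have lower: "f x + B (G x) (y - x) + (\<mu> / Lam) / 2 * B (y - x) (y - x) \<le> f y" for x y
  proof -
    have "B (y - x) (y - x) \<le> Lam * ip (y - x) (y - x)"
      unfolding B_def by (rule Rayleigh_bounds[OF ip symmetric eigenvalues])
    then have "(\<mu> / Lam / 2) * B (y - x) (y - x) \<le> (\<mu> / Lam / 2) * (Lam * ip (y - x) (y - x))"
      using mu_L Lam by (intro mult_left_mono) auto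
    then have "(\<mu> / Lam / 2) * B (y - x) (y - x) \<le> \<mu> / 2 * ip (y - x) (y - x)"
      using Lam by simp
    moreover have "f x + ip (gradient ip f x) (y - x) + \<mu> / 2 * ip (y - x) (y - x) \<le> f y"
      using convex unfolding strongly_convex_def ip_norm_sq[OF ip] by blast
    ultimately show ?thesis by (simp add: BG)
  qed
  have upper: "f y \<le> f x + B (G x) (y - x) + (L / lam) / 2 * B (y - x) (y - x)" for x y
  proof -
    have "lam * ip (y - x) (y - x) \<le> B (y - x) (y - x)"
      unfolding B_def by (rule Rayleigh_bounds[OF ip symmetric eigenvalues])
    then have "(L / lam / 2) * (lam * ip (y - x) (y - x)) \<le> (L / lam / 2) * B (y - x) (y - x)"
      using mu_L lam_Lam by (intro mult_left_mono) auto
    then have "L / 2 * ip (y - x) (y - x) \<le> (L / lam / 2) * B (y - x) (y - x)"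
      using lam_Lam by simp
    then show ?thesis
      using descent_lemma[OF ip smooth, of y x] by (simp add: BG)
  qed
  have pos: "0 < \<mu> / Lam" and le: "\<mu> / Lam \<le> L / lam"
    using mu_L lam_Lam by (auto intro!: frac_le)
  have rate: "f (xplus h) - f xstar \<le> (1 - h * \<mu> / Lam)\<^sup>2 * (f x - f xstar)"
    if "0 \<le> h" "h \<le> hbar" for h
    using gradient_step_rate[OF B pos le lower upper, of xstar h x] minimizer that hbar
    by (simp add: xplus G_def)
  moreover have "f (xplus hbar) - f xstar \<le> ((\<kappa> - 1) / (\<kappa> + 1))\<^sup>2 * (f x - f xstar)"
  proof -
    define a b where "a = L / lam" and "b = \<mu> / Lam"
    have ab: "0 < a" "0 < b"
      using mu_L lam_Lam by (auto simp: a_def b_def)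
    have "\<kappa> = a / b"
      using mu_L lam_Lam by (simp add: kappa a_def b_def)
    then have "(\<kappa> - 1) / (\<kappa> + 1) = ((a - b) / b) / ((a + b) / b)"
      using ab by (simp add: diff_divide_distrib add_divide_distrib)
    also have "\<dots> = (a - b) / (a + b)"
      using ab by simp
    also have "\<dots> = 1 - 2 / (a + b) * b"
      using ab by (simp add: field_simps)
    also have "\<dots> = 1 - hbar * \<mu> / Lam"
      by (simp add: hbar a_def b_def)
    finally have "1 - hbar * \<mu> / Lam = (\<kappa> - 1) / (\<kappa> + 1)" ..
    moreover have "0 \<le> hbar"
      using mu_L lam_Lam by (simp add: hbar)
    ultimately show ?thesis using rate[of hbar] by simp
  qed
  ultimately show ?thesis by blast
qed

end
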